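(* Assume that $a$ and $b$ are not both in $\mathbb{F}_q$. Assume further that $p=2$, $\Delta\equiv 0\pmod P$, $e_1$ exists and $e_1'=e_1$, and $v_P(b^k-1)=e_1$, where $k=\mathrm{ord}_P(b)$. Let $g_1=a/P^{e_1}$, $g_2=(b^k-1)/P^{e_1}$, and $m_2=v_P(g_1^2+bg_2^2)$. Define $m_3,m_4,\ldots$ and polynomials $g_3,g_4,\ldots$ by the following (finite or infinite) process: - if $m_2=e_1$, then define $g_3=(g_1^2+bg_2^2)/P^{e_1}$ and $m_3=v_P(g_1^6+bg_3^2)$; - for any $i\ge 3$, assuming $m_3,\ldots,m_i$ and $g_3,\ldots,g_i$ have been defined, if $m_i=e_1$, then define $g_{i+1}=(g_1^{2^i-2}+bg_i^2)/P^{e_1}$ and $m_{i+1}=v_P(g_1^{2^{i+1}-2}+bg_{i+1}^2)$. (If the stated condition $m_i=e_1$ fails, then the process stops and $m_{i+1}$ does not exist.) Then, if $m_2,\ldots,m_j$ exist but $m_{j+1}$ does not exist for some integer $j\ge 2$, then for any integer $i$ with $2\le i\le j$, $$e_i'=\begin{cases}(2^i-1)e_1 & \text{if } i<j,\\ \min\{(2^j-1)e_1,\ (2^j-2)e_1+m_j\} & \text{if } i=j,\end{cases}$$ and for any $i>j$, $e_i'=2^{i-j}e_j'$.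
   Context: Let $\mathbb{F}_q$ be the finite field with $q=p^l$ elements, $p$ prime, $l\ge1$. Fix $a,b\in\mathbb{F}_q[x]$ with $b\neq 0$, and put $\Delta=a^2+4b$. The generalized Fibonacci sequence is $F_0=0$, $F_1=1$, $F_n=aF_{n-1}+bF_{n-2}$ for $n\ge 2$. Fix an irreducible polynomial $P\in\mathbb{F}_q[x]$ with $\gcd(b,P)=1$. For a non-constant $M\in\mathbb{F}_q[x]$ with $\gcd(b,M)=1$, the rank $\alpha(M)$ is the least positive integer $n$ with $F_n\equiv 0\pmod M$, and the period $\pi(M)$ is the least positive integer $n$ with $F_n\equiv 0$ and $F_{n+1}\equiv 1\pmod M$. For $i\ge 1$, $e_i$ denotes the $i$-th smallest positive integer $e$ such that $\alpha(P^e)\neq\alpha(P^{e+1})$ (if it exists), and $e_i'$ denotes the $i$-th smallest positive integer $e$ such that $\pi(P^e)\neq\pi(P^{e+1})$ (if it exists; all $e_i'$ exist when $a,b$ are not both in $\mathbb{F}_q$). For $g$ coprime to $P$, $\mathrm{ord}_P(g)$ is the multiplicative order of $g$ modulo $P$. For nonzero $g\in\mathbb{F}_q[x]$, $v_P(g)$ is the largest integer $n$ with $P^n\mid g$, and $v_P(0)=+\infty$ (so an $m_i$ may be $+\infty$). Under the hypotheses of the claim, $v_P(a)=e_1$, so $g_1$ is a polynomial. *)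

theory Defs
  imports
    "HOL-Computational_Algebra.Computational_Algebra"
    "HOL-Number_Theory.Cong"
    "HOL-Library.Extended_Nat"
begin

fun gen_fib :: "'a::field poly \<Rightarrow> 'a poly \<Rightarrow> nat \<Rightarrow> 'a poly" where
  "gen_fib a b 0 = 0"
| "gen_fib a b (Suc 0) = 1"
| "gen_fib a b (Suc (Suc n)) = a * gen_fib a b (Suc n) + b * gen_fib a b n"

definition discr :: "'a::field poly \<Rightarrow> 'a poly \<Rightarrow> 'a poly" where
  "discr a b = a\<^sup>2 + 4 * b"

text \<open>For a finite field, non-constant \<open>M\<close> and \<open>coprime b M\<close>, the minima in
  \<open>rank_mod\<close>, \<open>period_mod\<close> and \<open>ord_mod\<close> (for \<open>ord_mod\<close>, \<open>coprime g P\<close>)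
  range over nonempty sets, so the \<open>LEAST\<close> operators are meaningful.\<close>

definition rank_mod :: "'a::field poly \<Rightarrow> 'a poly \<Rightarrow> 'a poly \<Rightarrow> nat" where
  "rank_mod a b M = (LEAST n. n > 0 \<and> [gen_fib a b n = 0] (mod M))"

definition period_mod :: "'a::field poly \<Rightarrow> 'a poly \<Rightarrow> 'a poly \<Rightarrow> nat" where
  "period_mod a b M =
     (LEAST n. n > 0 \<and> [gen_fib a b n = 0] (mod M) \<and> [gen_fib a b (n + 1) = 1] (mod M))"

definition ord_mod :: "'a::field poly \<Rightarrow> 'a poly \<Rightarrow> nat" where
  "ord_mod P g = (LEAST n. n > 0 \<and> [g ^ n = 1] (mod P))"

text \<open>\<open>multiplicity\<close> is avoided because it needs more than \<open>field\<close> of the coefficients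
  and gives \<open>0\<close>, rather than infinity, at the zero polynomial. For non-constant \<open>P\<close> and \<open>g \<noteq> 0\<close>
  the greatest \<open>n\<close> exists.\<close>

definition val :: "'a::field poly \<Rightarrow> 'a poly \<Rightarrow> enat" where
  "val P g = (if g = 0 then \<infinity> else enat (GREATEST n. P ^ n dvd g))"

text \<open>\<open>ith_smallest S i e\<close>: the \<open>i\<close>-th smallest element of \<open>S\<close> (counting from \<open>i = 1\<close>)
  exists and equals \<open>e\<close>.\<close>

definition ith_smallest :: "nat set \<Rightarrow> nat \<Rightarrow> nat \<Rightarrow> bool" where
  "ith_smallest S i e \<longleftrightarrow> e \<in> S \<and> card {x \<in> S. x \<le> e} = i"

text \<open>\<open>is_e a b P i e\<close> reads: \<open>e\<^sub>i\<close> exists and equals \<open>e\<close>; similarly \<open>is_e'\<close> for \<open>e\<^sub>i'\<close>.\<close>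

definition is_e :: "'a::field poly \<Rightarrow> 'a poly \<Rightarrow> 'a poly \<Rightarrow> nat \<Rightarrow> nat \<Rightarrow> bool" where
  "is_e a b P = ith_smallest {e. e > 0 \<and> rank_mod a b (P ^ e) \<noteq> rank_mod a b (P ^ (e + 1))}"

definition is_e' :: "'a::field poly \<Rightarrow> 'a poly \<Rightarrow> 'a poly \<Rightarrow> nat \<Rightarrow> nat \<Rightarrow> bool" where
  "is_e' a b P = ith_smallest {e. e > 0 \<and> period_mod a b (P ^ e) \<noteq> period_mod a b (P ^ (e + 1))}"

text \<open>\<open>process b P e\<^sub>1 g\<^sub>1 g\<^sub>2 i g m\<close> reads: the process, started from \<open>g\<^sub>1\<close> and \<open>g\<^sub>2\<close>, reaches
  index \<open>i\<close>, where \<open>g\<^sub>i = g\<close> and \<open>m\<^sub>i = m\<close>. The passage from index 2 to index 3 is the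
  instance \<open>i = 2\<close> of \<open>step\<close>, as \<open>2\<^sup>2 - 2 = 2\<close> and \<open>2\<^sup>3 - 2 = 6\<close>.\<close>

inductive process ::
    "'a::field poly \<Rightarrow> 'a poly \<Rightarrow> nat \<Rightarrow> 'a poly \<Rightarrow> 'a poly \<Rightarrow> nat \<Rightarrow> 'a poly \<Rightarrow> enat \<Rightarrow> bool"
  for b P :: "'a poly" and e1 :: nat and g1 g2 :: "'a poly" where
  start: "process b P e1 g1 g2 2 g2 (val P (g1\<^sup>2 + b * g2\<^sup>2))"
| step: "\<lbrakk>process b P e1 g1 g2 i g m; m = enat e1; g' = (g1 ^ (2 ^ i - 2) + b * g\<^sup>2) div P ^ e1\<rbrakk>
    \<Longrightarrow> process b P e1 g1 g2 (i + 1) g' (val P (g1 ^ (2 ^ (i + 1) - 2) + b * g'\<^sup>2))"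

end

theory Submission
  imports Defs "HOL-Number_Theory.Residues"
begin

text \<open>Adjoin a root \<open>t\<close> of \<open>t\<^sup>2 = a t + b\<close>. Then \<open>t ^ n = F\<^sub>n t + H\<^sub>n + 1\<close>, where
  \<open>H\<^sub>n = F\<^sub>n\<^sub>+\<^sub>1 - a F\<^sub>n - 1\<close>, so the period modulo \<open>P ^ e\<close> is the order of \<open>t\<close>, that is, the least
  positive \<open>n\<close> for which \<open>P ^ e\<close> divides both \<open>F\<^sub>n\<close> and \<open>H\<^sub>n\<close>. In characteristic 2 the discriminant is
  \<open>a\<^sup>2\<close>, so \<open>P\<close> divides \<open>a\<close>, and squaring \<open>t ^ n - 1\<close> gives the two doubling formulas
  \<open>F\<^sub>2\<^sub>n = a F\<^sub>n\<^sup>2\<close> and \<open>H\<^sub>2\<^sub>n = H\<^sub>n\<^sup>2 + b F\<^sub>n\<^sup>2\<close>, from which everything follows.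

  Modulo \<open>P\<close> we have \<open>t\<^sup>2 = b\<close>, and the order of \<open>t\<close> is \<open>2 k\<close>, with \<open>k\<close> odd. Since \<open>t ^ (2 k) - 1\<close> is
  divisible by \<open>P\<close> and raising to the power \<open>2 ^ s\<close> is additive, each period modulo a power of \<open>P\<close>
  is some \<open>2 ^ i * k\<close> with \<open>i \<ge> 1\<close>. Let \<open>V\<^sub>i\<close> be the largest \<open>e\<close> such that \<open>P ^ e\<close>
  divides \<open>F\<close> and \<open>H\<close> at the index \<open>2 ^ i * k\<close>. The \<open>V\<^sub>i\<close> strictly increase, and they are exactly
  the places where the period changes, so \<open>V\<^sub>i\<close> is the \<open>i\<close>-th period jump (\<open>is_e'_of_level\<close>).

  To find \<open>V\<^sub>i\<close>, compute the valuations of the two coordinates. The first is closed form: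
  \<open>F\<close> at \<open>2 ^ i * k\<close> is \<open>a ^ (2 ^ i - 1) * F\<^sub>k ^ (2 ^ i)\<close> with \<open>F\<^sub>k\<close> prime to \<open>P\<close>, hence has valuation
  \<open>(2 ^ i - 1) e\<^sub>1\<close> (the first rank jump being the valuation of \<open>a\<close>). For the second, the doubling
  formula shows inductively that up to a power of \<open>b\<close> and modulo \<open>P ^ (2 ^ i * e\<^sub>1)\<close>, \<open>H\<close> at
  \<open>2 ^ i * k\<close> is \<open>P ^ ((2 ^ i - 2) e\<^sub>1) * (g\<^sub>1 ^ (2 ^ i - 2) + b g\<^sub>i\<^sup>2)\<close> (\<open>H_residual\<close>): one run of the
  process is one doubling, and dividing by \<open>P ^ e\<^sub>1\<close> is possible as long as \<open>m\<^sub>i = e\<^sub>1\<close>. So, for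
  \<open>2 \<le> i \<le> j\<close>, \<open>V\<^sub>i\<close> is the minimum of \<open>(2 ^ i - 1) e\<^sub>1\<close> and \<open>(2 ^ i - 2) e\<^sub>1 + m\<^sub>i\<close> (\<open>level_of_residual\<close>).

  The process stops exactly when \<open>m\<^sub>j \<noteq> e\<^sub>1\<close>, which says that the two coordinates have different
  valuations. Then no cancellation can occur in \<open>H\<^sub>n\<^sup>2 + b F\<^sub>n\<^sup>2\<close>, while \<open>a F\<^sub>n\<^sup>2\<close> has a strictly larger
  valuation than the minimum; so the valuations stay different and their minimum doubles
  from there on (\<open>unbalanced_double\<close>).\<close>

section \<open>The valuation as a divisibility test\<close>

lemma power_dvd_imp_le_degree:
  fixes P x :: "'a::field poly"
  assumes "\<not> is_unit P" "P \<noteq> 0" "x \<noteq> 0" "P ^ n dvd x"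
  shows "n \<le> degree x"
proof -
  have "degree P > 0"
    using assms(1,2) is_unit_iff_degree by blast
  then have "n \<le> degree (P ^ n)"
    using assms(2) by (simp add: degree_power_eq)
  also have "\<dots> \<le> degree x"
    using assms(3,4) by (rule dvd_imp_degree_le[rotated])
  finally show ?thesis .
qed

lemma enat_le_val_iff:
  fixes P x :: "'a::field poly"
  assumes "\<not> is_unit P" "P \<noteq> 0"
  shows "enat n \<le> val P x \<longleftrightarrow> P ^ n dvd x"
proof (cases "x = 0")
  case False
  let ?G = "GREATEST n. P ^ n dvd x"
  have bound: "\<And>n. P ^ n dvd x \<Longrightarrow> n \<le> degree x"
    using power_dvd_imp_le_degree[OF assms False] .
  have "P ^ ?G dvd x"
    by (rule GreatestI_nat[of _ 0 "degree x"]) (use bound in auto)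
  moreover have "n \<le> ?G" if "P ^ n dvd x"
    using that bound by (rule Greatest_le_nat)
  ultimately show ?thesis
    using False by (auto simp: val_def intro: power_le_dvd)
qed (simp add: val_def)

section \<open>Addition formulas and periods\<close>

text \<open>The two addition formulas are the coordinates of \<open>t ^ (m + n) = t ^ m * t ^ n\<close> with respect to
  the basis \<open>t, 1\<close>, where \<open>t\<^sup>2 = a t + b\<close>.\<close>

lemma gen_fib_add:
  "gen_fib a b (m + n) =
     gen_fib a b m * gen_fib a b (Suc n) + (gen_fib a b (Suc m) - a * gen_fib a b m) * gen_fib a b n"
proof (induction n rule: induct_nat_012)
  case (ge2 n)
  have "gen_fib a b (m + Suc (Suc n)) = a * gen_fib a b (m + Suc n) + b * gen_fib a b (m + n)"
    by simp
  then show ?case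
    unfolding ge2.IH by (simp add: algebra_simps)
qed auto

lemma gen_fib_add_Suc:
  "gen_fib a b (Suc (m + n)) =
     gen_fib a b (Suc m) * gen_fib a b (Suc n) + b * gen_fib a b m * gen_fib a b n"
  using gen_fib_add[of a b m "Suc n"] by (simp add: algebra_simps)

text \<open>The constant coordinate of \<open>t ^ n - 1\<close>. That of \<open>t ^ n\<close> is \<open>b\<close> times the Fibonacci term of
  index \<open>n - 1\<close>; the recursion turns it into an expression that also makes sense for \<open>n = 0\<close>.\<close>

definition unit_defect :: "'a::field poly \<Rightarrow> 'a poly \<Rightarrow> nat \<Rightarrow> 'a poly" where
  "unit_defect a b n = gen_fib a b (Suc n) - a * gen_fib a b n - 1"

text \<open>The condition \<open>t ^ n \<equiv> 1\<close>, in the form in which \<open>period_mod\<close> uses it. It also holds for \<open>n = 0\<close>.\<close>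

definition returns_mod :: "'a::field poly \<Rightarrow> 'a poly \<Rightarrow> 'a poly \<Rightarrow> nat \<Rightarrow> bool" where
  "returns_mod a b M n \<longleftrightarrow> [gen_fib a b n = 0] (mod M) \<and> [gen_fib a b (Suc n) = 1] (mod M)"

lemma returns_mod_iff:
  "returns_mod a b M n \<longleftrightarrow> M dvd gen_fib a b n \<and> M dvd unit_defect a b n"
proof -
  have "M dvd unit_defect a b n \<longleftrightarrow> M dvd gen_fib a b (Suc n) - 1" if "M dvd gen_fib a b n"
  proof -
    have "unit_defect a b n = (gen_fib a b (Suc n) - 1) - a * gen_fib a b n"
      by (simp add: unit_defect_def)
    then show ?thesis
      using that by (simp add: dvd_diff_left_iff)
  qed
  then show ?thesis
    by (auto simp: returns_mod_def cong_0_iff cong_iff_dvd_diff)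
qed

text \<open>This is \<open>t ^ (m + n) \<equiv> t ^ n\<close> for \<open>t ^ m \<equiv> 1\<close>. It makes the set of periods closed under
  subtraction as well, so that all periods are multiples of the least one.\<close>

lemma returns_mod_add:
  assumes "returns_mod a b M m"
  shows "returns_mod a b M (m + n) \<longleftrightarrow> returns_mod a b M n"
proof -
  let ?F = "gen_fib a b"
  have m: "[?F m = 0] (mod M)" "[?F (Suc m) = 1] (mod M)"
    using assms by (auto simp: returns_mod_def)
  have "[?F m * ?F (Suc n) + (?F (Suc m) - a * ?F m) * ?F n
        = 0 * ?F (Suc n) + (1 - a * 0) * ?F n] (mod M)"
    by (intro cong_add cong_mult cong_diff m cong_refl)
  then have 1: "[?F (m + n) = ?F n] (mod M)"
    by (simp add: gen_fib_add)
  have "[?F (Suc m) * ?F (Suc n) + b * ?F m * ?F n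
        = 1 * ?F (Suc n) + b * 0 * ?F n] (mod M)"
    by (intro cong_add cong_mult m cong_refl)
  then have 2: "[?F (Suc (m + n)) = ?F (Suc n)] (mod M)"
    by (simp add: gen_fib_add_Suc)
  show ?thesis
    unfolding returns_mod_def using 1 2 by (meson cong_sym cong_trans)
qed

lemma period_mod_props:
  assumes "n > 0" "returns_mod a b M n"
  shows period_mod_pos: "period_mod a b M > 0"
    and returns_mod_period: "returns_mod a b M (period_mod a b M)"
    and period_mod_dvd: "period_mod a b M dvd n"
proof -
  let ?T = "period_mod a b M"
  have eq: "?T = (LEAST n. n > 0 \<and> returns_mod a b M n)"
    by (simp add: period_mod_def returns_mod_def)
  have T: "?T > 0 \<and> returns_mod a b M ?T"
    unfolding eq by (rule LeastI[of _ n]) (use assms in simp)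
  then show "?T > 0" "returns_mod a b M ?T" by auto
  have mult: "returns_mod a b M (?T * q + r) \<longleftrightarrow> returns_mod a b M r" for q r
    by (induction q) (use T in \<open>auto simp: returns_mod_add add.assoc\<close>)
  have "returns_mod a b M (n mod ?T)"
    using mult[of "n div ?T" "n mod ?T"] assms by simp
  moreover have "n mod ?T < ?T"
    using T by simp
  ultimately have "n mod ?T = 0"
    using not_less_Least[of "n mod ?T" "\<lambda>n. n > 0 \<and> returns_mod a b M n"] by (auto simp flip: eq)
  then show "?T dvd n"
    by auto
qed

section \<open>Level sets of a strictly increasing sequence\<close>

lemma ith_smallest_range:
  assumes "strict_mono (U :: nat \<Rightarrow> nat)"
  shows "ith_smallest (range U) (Suc i) (U i)"
proof -
  have "{x \<in> range U. x \<le> U i} = U ` {..i}"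
    using assms by (auto simp: strict_mono_less_eq)
  moreover have "card (U ` {..i}) = Suc i"
    using assms by (subst card_image) (auto simp: strict_mono_imp_inj_on inj_on_subset)
  ultimately show ?thesis
    by (simp add: ith_smallest_def)
qed

lemma strict_mono_exceeds:
  assumes "strict_mono (U :: nat \<Rightarrow> nat)"
  shows "\<exists>i. e \<le> U i"
  using strict_mono_imp_increasing[OF assms] by blast

text \<open>A function that depends injectively on the first level \<open>U i\<close> at or above its argument changes
  from \<open>e\<close> to \<open>e + 1\<close> exactly when \<open>e\<close> is itself a level. It is applied to the period
  modulo \<open>P ^ e\<close> as a function of \<open>e\<close>.\<close>

lemma jumps_eq_range:
  fixes U :: "nat \<Rightarrow> nat"
  assumes mono: "strict_mono U" and pos: "U 0 > 0"
    and f: "\<And>e. e > 0 \<Longrightarrow> f e = c (LEAST i. e \<le> U i)" and "inj c"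
  shows "{e. e > 0 \<and> f e \<noteq> f (e + 1)} = range U"
proof -
  let ?L = "\<lambda>e. LEAST i. e \<le> U i"
  have le: "e \<le> U (?L e)" for e
    using strict_mono_exceeds[OF mono] by (rule LeastI_ex)
  have "f e \<noteq> f (e + 1) \<longleftrightarrow> e \<in> range U" if "e > 0" for e
  proof -
    have "?L e = ?L (e + 1) \<longleftrightarrow> e \<notin> range U"
    proof
      assume "?L e = ?L (e + 1)"
      show "e \<notin> range U"
      proof
        assume "e \<in> range U"
        then obtain i where i: "e = U i" by auto
        then have "?L e \<le> i" by (intro Least_le) simp
        then have "U (?L (e + 1)) \<le> e"
          using i mono \<open>?L e = ?L (e + 1)\<close> by (simp add: strict_mono_less_eq)
        then show False
          using le[of "e + 1"] by simp
      qed
    next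
      assume "e \<notin> range U"
      then have "(e \<le> U i) = (e + 1 \<le> U i)" for i
        by (metis Suc_eq_plus1 Suc_le_eq le_neq_implies_less less_or_eq_imp_le rangeI)
      then show "?L e = ?L (e + 1)" by simp
    qed
    then show ?thesis
      using f[OF that] f[of "e + 1"] \<open>inj c\<close> by (auto simp: inj_eq)
  qed
  moreover have "e > 0" if "e \<in> range U" for e
    using that pos mono by (auto simp: strict_mono_less_eq intro: less_le_trans[of 0 "U 0"])
  ultimately show ?thesis by blast
qed

section \<open>Characteristic two with \<open>P\<close> dividing the discriminant\<close>

locale char2_fib =
  fixes a b P :: "'a::field poly"
  assumes two_eq_0: "(2 :: 'a poly) = 0"
    and prime_P: "prime_elem P"
    and b_nondvd: "\<not> P dvd b"
    and P_dvd_a: "P dvd a"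
begin

abbreviation F where "F \<equiv> gen_fib a b"
abbreviation H where "H \<equiv> unit_defect a b"

lemma P_nonzero: "P \<noteq> 0" and P_nonunit: "\<not> is_unit P"
  using prime_P by (auto simp: prime_elem_def)

lemma double_eq_0: "(x :: 'a poly) + x = 0"
  by (metis mult_2 mult_zero_left two_eq_0)

lemma diff_eq_add: "(x :: 'a poly) - y = x + y"
  using double_eq_0[of y] by (simp add: diff_eq_eq add.assoc)

lemma square_add: "((x :: 'a poly) + y)\<^sup>2 = x\<^sup>2 + y\<^sup>2"
  by (simp add: power2_sum two_eq_0)

lemmas val_iff = enat_le_val_iff[OF P_nonunit P_nonzero]

lemma P_pow_dvd_iff: "P ^ e dvd P ^ n \<longleftrightarrow> e \<le> n"
  using P_nonzero P_nonunit by (simp add: dvd_power_iff)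

lemma P_pow_dvd_mult_iff:
  assumes "\<not> P dvd c"
  shows "P ^ e dvd c * x \<longleftrightarrow> P ^ e dvd x"
proof
  assume "P ^ e dvd c * x"
  then show "P ^ e dvd x"
    using prime_P assms
  proof (induction e arbitrary: x)
    case (Suc e)
    then have "P dvd c * x"
      by (metis dvd_mult_left power_Suc)
    then obtain y where y: "x = P * y"
      using Suc.prems prime_elem_dvd_mult_iff by (metis dvdE)
    have "P * P ^ e dvd P * (c * y)"
      using Suc.prems(1) by (simp add: y mult_ac)
    then have "P ^ e dvd c * y"
      using P_nonzero by simp
    then have "P ^ e dvd y"
      using Suc.IH Suc.prems(2,3) by blast
    then show ?case
      by (simp add: y)
  qed simp
qed simp

lemma F_double: "F (2 * n) = a * (F n)\<^sup>2"
proof -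
  have "F (2 * n) = F n * F (Suc n) + (F (Suc n) - a * F n) * F n"
    using gen_fib_add[of a b n n] by (simp add: mult_2)
  also have "\<dots> = (F n * F (Suc n) + F n * F (Suc n)) + a * (F n)\<^sup>2"
    by (simp add: diff_eq_add algebra_simps power2_eq_square)
  finally show ?thesis by (simp add: double_eq_0)
qed

lemma F_double_Suc: "F (Suc (2 * n)) = (F (Suc n))\<^sup>2 + b * (F n)\<^sup>2"
  using gen_fib_add_Suc[of a b n n] by (simp add: mult_2 power2_eq_square mult.assoc)

text \<open>The constant coordinate of \<open>t ^ (2 n) - 1 = (t ^ n - 1)\<^sup>2\<close>: with \<open>x = F n\<close> and \<open>y = H n\<close> the right
  side is \<open>(x t + y)\<^sup>2 = x\<^sup>2 (a t + b) + y\<^sup>2\<close>.\<close>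

lemma H_double: "H (2 * n) = (H n)\<^sup>2 + b * (F n)\<^sup>2"
proof -
  have "H (2 * n) = (F (Suc n))\<^sup>2 + b * (F n)\<^sup>2 + a * (a * (F n)\<^sup>2) + 1"
    by (simp add: unit_defect_def F_double F_double_Suc diff_eq_add)
  also have "\<dots> = (H n)\<^sup>2 + b * (F n)\<^sup>2"
    by (simp add: unit_defect_def diff_eq_add square_add power_mult_distrib power2_eq_square[of a]
        algebra_simps)
  finally show ?thesis .
qed

lemma F_two_power_mult: "F (2 ^ i * n) = a ^ (2 ^ i - 1) * F n ^ (2 ^ i)"
proof (induction i)
  case (Suc i)
  have "F (2 ^ Suc i * n) = a * (F (2 ^ i * n))\<^sup>2"
    by (simp only: power_Suc mult.assoc F_double)
  also have "\<dots> = a ^ Suc (2 * (2 ^ i - 1)) * F n ^ (2 * 2 ^ i)"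
    unfolding Suc.IH by (simp only: power_Suc power_even_eq power_mult_distrib mult.assoc)
  also have "Suc (2 * (2 ^ i - 1)) = 2 ^ Suc i - (1::nat)"
    using one_le_power[of "2::nat" i] by (simp only: power_Suc) linarith
  finally show ?case by (simp only: power_Suc)
qed simp

text \<open>Modulo \<open>a\<close> the recursion is \<open>F (n + 2) = b * F n\<close>.\<close>

lemma F_mod_a: "a dvd F (2 * n)" "a dvd F (Suc (2 * n)) - b ^ n"
proof -
  have "a dvd F (2 * n) \<and> a dvd F (Suc (2 * n)) - b ^ n"
  proof (induction n)
    case (Suc n)
    have "F (Suc (2 * Suc n)) - b ^ Suc n =
        a * F (2 * Suc n) + b * (F (Suc (2 * n)) - b ^ n)"
      by (simp add: algebra_simps)
    then show ?case
      using Suc.IH by (simp only: F_double) (simp add: mult.assoc)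
  qed simp
  then show "a dvd F (2 * n)" "a dvd F (Suc (2 * n)) - b ^ n" by auto
qed

lemma P_nondvd_b_power: "\<not> P dvd b ^ n"
  using prime_P b_nondvd prime_elem_dvd_power by blast

lemma P_nondvd_F_odd: "\<not> P dvd F (Suc (2 * n))"
proof
  assume "P dvd F (Suc (2 * n))"
  moreover have "P dvd F (Suc (2 * n)) - b ^ n"
    using F_mod_a(2) P_dvd_a by (rule dvd_trans[rotated])
  ultimately have "P dvd b ^ n"
    by (metis dvd_diff_right_iff)
  then show False using P_nondvd_b_power by simp
qed

subsection \<open>The rank\<close>

text \<open>\<open>F 1 = 1\<close> and \<open>F 2 = a\<close>, so 2 is the smallest conceivable rank. Powers of 2 supply an index with
  \<open>F\<close> divisible by \<open>P ^ e\<close>, because \<open>F (2 ^ e)\<close> is a power of \<open>a\<close> with exponent at least \<open>e\<close>; this is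
  what makes the rank meaningful.\<close>

lemma rank_mod_eq_2_iff:
  assumes "e > 0"
  shows "rank_mod a b (P ^ e) = 2 \<longleftrightarrow> P ^ e dvd a"
proof -
  let ?Q = "\<lambda>n. n > 0 \<and> [F n = 0] (mod P ^ e)"
  have F2: "F 2 = a"
    by (simp add: numeral_2_eq_2)
  have not1: "\<not> ?Q 1"
    using assms P_nonunit by (simp add: cong_0_iff is_unit_power_iff)
  have "P ^ e dvd F (2 ^ e)"
  proof -
    have "F (2 ^ e) = a ^ (2 ^ e - 1)"
      using F_two_power_mult[of e 1] by simp
    moreover have "P ^ e dvd a ^ e"
      using P_dvd_a by (rule dvd_power_same)
    moreover have "e \<le> 2 ^ e - 1"
      using less_exp[of e] by linarith
    ultimately show ?thesis
      by (metis dvd_trans le_imp_power_dvd)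
  qed
  then have Q: "?Q (rank_mod a b (P ^ e))"
    unfolding rank_mod_def by (intro LeastI[of ?Q "2 ^ e"]) (simp add: cong_0_iff)
  show ?thesis
  proof
    assume "rank_mod a b (P ^ e) = 2"
    then show "P ^ e dvd a"
      using Q F2 by (simp add: cong_0_iff)
  next
    assume "P ^ e dvd a"
    then have "?Q 2" using F2 by (simp add: cong_0_iff)
    then have "rank_mod a b (P ^ e) \<le> 2"
      unfolding rank_mod_def by (rule Least_le)
    moreover have "rank_mod a b (P ^ e) \<noteq> 1" "rank_mod a b (P ^ e) > 0"
      using Q not1 by metis+
    ultimately show "rank_mod a b (P ^ e) = 2" by simp
  qed
qed

text \<open>Up to the first jump the rank keeps its value 2 from \<open>P\<close>, and after it the rank is not 2. So the
  first jump is the exponent of \<open>P\<close> in \<open>a\<close>.\<close>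

lemma first_rank_jump:
  assumes "is_e a b P 1 e"
  shows "e > 0" "P ^ e dvd a" "\<not> P ^ Suc e dvd a"
proof -
  let ?r = "\<lambda>e. rank_mod a b (P ^ e)"
  define S where "S = {e. e > 0 \<and> ?r e \<noteq> ?r (e + 1)}"
  have S: "e \<in> S" and card: "card {x \<in> S. x \<le> e} = 1"
    using assms by (auto simp: is_e_def ith_smallest_def S_def)
  show "e > 0" using S by (simp add: S_def)
  have first: "x = e" if "x \<in> S" "x \<le> e" for x
  proof -
    obtain y where y: "{x \<in> S. x \<le> e} = {y}"
      using card by (metis card_1_singletonE)
    have "x \<in> {x \<in> S. x \<le> e}" "e \<in> {x \<in> S. x \<le> e}"
      using that S by auto
    then show ?thesis unfolding y by simp
  qed
  have "?r n = 2" if "0 < n" "n \<le> e" for n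
    using that
  proof (induction n rule: nat_induct_non_zero)
    case 1
    then show ?case using rank_mod_eq_2_iff[of 1] P_dvd_a by simp
  next
    case (Suc n)
    then have "n \<notin> S" using first[of n] by auto
    then show ?case using Suc by (auto simp: S_def)
  qed
  then have re: "?r e = 2" using \<open>e > 0\<close> by simp
  then show "P ^ e dvd a" using rank_mod_eq_2_iff \<open>e > 0\<close> by blast
  have "?r (Suc e) \<noteq> 2" using S re by (auto simp: S_def)
  then show "\<not> P ^ Suc e dvd a" using rank_mod_eq_2_iff by blast
qed

subsection \<open>The largest power of \<open>P\<close> modulo which an index is a period\<close>

definition has_level :: "nat \<Rightarrow> nat \<Rightarrow> bool" where
  "has_level n V \<longleftrightarrow> (\<forall>e. returns_mod a b (P ^ e) n \<longleftrightarrow> e \<le> V)"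

lemma has_level_unique: "has_level n V \<Longrightarrow> has_level n W \<Longrightarrow> V = W"
  by (metis has_level_def le_antisym le_refl)

lemma returns_mod_P_pow_le:
  "returns_mod a b (P ^ e) n \<Longrightarrow> d \<le> e \<Longrightarrow> returns_mod a b (P ^ d) n"
  unfolding returns_mod_iff by (meson dvd_trans le_imp_power_dvd)

lemma has_levelI:
  assumes "returns_mod a b (P ^ V) n" "\<not> returns_mod a b (P ^ Suc V) n"
  shows "has_level n V"
  unfolding has_level_def using assms returns_mod_P_pow_le by (metis not_less_eq_eq)

text \<open>Squaring \<open>t ^ n - 1\<close> doubles the exponent of a power of \<open>P\<close> that divides it.\<close>

lemma has_level_double_gt:
  assumes "has_level n V" "has_level (2 * n) W" "V > 0"
  shows "V < W"
proof -
  have "returns_mod a b (P ^ V) n"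
    using assms(1) by (simp add: has_level_def)
  then have "P ^ V dvd F n" "P ^ V dvd H n"
    by (auto simp: returns_mod_iff)
  then have "(P ^ V)\<^sup>2 dvd (F n)\<^sup>2" "(P ^ V)\<^sup>2 dvd (H n)\<^sup>2"
    by (simp_all add: dvd_power_same)
  then have "returns_mod a b (P ^ (2 * V)) (2 * n)"
    unfolding returns_mod_iff F_double H_double power_even_eq by simp
  then have "2 * V \<le> W"
    using assms(2) by (simp add: has_level_def)
  then show ?thesis using assms(3) by simp
qed

text \<open>The two coordinates of \<open>t ^ n - 1\<close> have different valuations at \<open>P\<close>, the smaller of which is \<open>V\<close>.\<close>

definition unbalanced :: "nat \<Rightarrow> nat \<Rightarrow> bool" where
  "unbalanced n V \<longleftrightarrow> P ^ V dvd F n \<and> P ^ V dvd H n \<and>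
     (P ^ Suc V dvd F n \<longleftrightarrow> \<not> P ^ Suc V dvd H n)"

lemma unbalanced_imp_has_level: "unbalanced n V \<Longrightarrow> has_level n V"
  by (rule has_levelI) (auto simp: unbalanced_def returns_mod_iff)

text \<open>Exactly one of \<open>h\<close> and \<open>f\<close> below is divisible by \<open>P\<close>, so \<open>h\<^sup>2 + b f\<^sup>2\<close> is not; and the factor \<open>a\<close>
  puts an extra \<open>P\<close> into the other coordinate.\<close>

lemma unbalanced_double:
  assumes "unbalanced n V"
  shows "unbalanced (2 * n) (2 * V)"
proof -
  obtain f h where f: "F n = P ^ V * f" and h: "H n = P ^ V * h"
    using assms by (auto simp: unbalanced_def elim!: dvdE)
  have P_dvd: "P ^ Suc V dvd P ^ V * x \<longleftrightarrow> P dvd x" for x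
    using P_nonzero by (simp only: power_Suc2 dvd_mult_cancel_left) simp
  have xor: "P dvd f \<longleftrightarrow> \<not> P dvd h"
    using assms by (simp add: unbalanced_def f h P_dvd del: power_Suc)
  have F2: "F (2 * n) = P ^ (2 * V) * (a * f\<^sup>2)"
    unfolding F_double f
    by (simp only: power_mult_distrib power_even_eq mult.left_commute)
  have H2: "H (2 * n) = P ^ (2 * V) * (h\<^sup>2 + b * f\<^sup>2)"
    unfolding H_double f h
    by (simp only: power_mult_distrib power_even_eq distrib_left mult.left_commute)
  have P_dvd2: "P ^ Suc (2 * V) dvd P ^ (2 * V) * x \<longleftrightarrow> P dvd x" for x
    using P_nonzero by (simp only: power_Suc2 dvd_mult_cancel_left) simp
  have sq: "P dvd x\<^sup>2 \<longleftrightarrow> P dvd x" "P dvd b * x\<^sup>2 \<longleftrightarrow> P dvd x" for x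
    using prime_P b_nondvd by (auto simp: prime_elem_dvd_power_iff prime_elem_dvd_mult_iff)
  have "\<not> P dvd h\<^sup>2 + b * f\<^sup>2"
    using xor sq by (metis dvd_add_left_iff dvd_add_right_iff)
  then show ?thesis
    unfolding unbalanced_def F2 H2 P_dvd2 using P_dvd_a by auto
qed

lemma unbalanced_two_power:
  assumes "unbalanced n V"
  shows "unbalanced (2 ^ s * n) (2 ^ s * V)"
proof (induction s)
  case (Suc s)
  then show ?case using unbalanced_double[of "2 ^ s * n" "2 ^ s * V"] by (simp add: mult.assoc)
qed (use assms in simp)

end

section \<open>The level along the doublings of the order of \<open>b\<close>\<close>

lemma pred_mult_eq: "2 \<le> N \<Longrightarrow> (N - 1) * e = (N - 2) * e + (e :: nat)"
  by (auto dest!: le_Suc_ex)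

text \<open>Here \<open>e1\<close> is the exact exponent of \<open>P\<close> in \<open>a\<close> and \<open>k\<close> is the order of \<open>b\<close> modulo \<open>P\<close>.\<close>

locale char2_fib_order = char2_fib +
  fixes e1 k :: nat and g1 g2 :: "'a poly"
  assumes e1_pos: "e1 > 0" and a_eq: "a = P ^ e1 * g1" and g1_nondvd: "\<not> P dvd g1"
    and k_pos: "k > 0" and b_power: "b ^ k - 1 = P ^ e1 * g2"
    and k_least: "\<And>n. 0 < n \<Longrightarrow> n < k \<Longrightarrow> \<not> P dvd b ^ n - 1"
begin

lemma P_dvd_b_power_k: "P dvd b ^ k - 1"
  using b_power e1_pos by (simp add: dvd_power)

text \<open>Since \<open>b ^ (2 n) - 1 = (b ^ n - 1)\<^sup>2\<close>, an even order could be halved.\<close>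

lemma odd_k: "odd k"
proof
  assume "even k"
  then obtain n where n: "k = 2 * n" by auto
  have "(b ^ n - 1)\<^sup>2 = b ^ k - 1"
    by (simp add: n diff_eq_add square_add power_mult[symmetric] mult.commute)
  then have "P dvd b ^ n - 1"
    using P_dvd_b_power_k prime_P prime_elem_dvd_power by metis
  then show False
    using k_least[of n] n k_pos by auto
qed

lemma k_dvd:
  assumes "P dvd b ^ n - 1"
  shows "k dvd n"
proof -
  have "[b ^ k = 1] (mod P)"
    using P_dvd_b_power_k by (simp add: cong_iff_dvd_diff)
  then have "[(b ^ k) ^ (n div k) * b ^ (n mod k) = 1 ^ (n div k) * b ^ (n mod k)] (mod P)"
    by (intro cong_mult cong_pow cong_refl)
  then have "[b ^ n = b ^ (n mod k)] (mod P)"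
    by (simp add: power_mult[symmetric] power_add[symmetric])
  then have "[b ^ (n mod k) = 1] (mod P)"
    using assms by (metis cong_iff_dvd_diff cong_sym cong_trans)
  then have "n mod k = 0"
    using k_least[of "n mod k"] k_pos by (auto simp: cong_iff_dvd_diff)
  then show ?thesis by auto
qed

text \<open>Modulo \<open>P\<close> we have \<open>t\<^sup>2 = b\<close>, so odd powers of \<open>t\<close> are \<open>t\<close> times a unit, and even ones are powers of \<open>b\<close>.\<close>

lemma returns_mod_P_iff:
  "returns_mod a b P n \<longleftrightarrow> 2 * k dvd n"
proof
  assume R: "returns_mod a b P n"
  have "even n"
    using R P_nondvd_F_odd[of "n div 2"] by (cases "even n") (auto simp: returns_mod_iff)
  then obtain q where q: "n = 2 * q" by auto
  have "P dvd F (Suc n) - 1"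
    using R by (simp add: returns_mod_def cong_iff_dvd_diff)
  moreover have "P dvd F (Suc n) - b ^ q"
    unfolding q by (rule dvd_trans[OF P_dvd_a F_mod_a(2)])
  ultimately have "P dvd (F (Suc n) - 1) - (F (Suc n) - b ^ q)"
    by (rule dvd_diff)
  then have "k dvd q"
    by (intro k_dvd) simp
  then show "2 * k dvd n" using q by simp
next
  assume "2 * k dvd n"
  then obtain r where r: "n = 2 * (k * r)" unfolding dvd_def mult.assoc by blast
  have "P dvd F n"
    unfolding r by (rule dvd_trans[OF P_dvd_a F_mod_a(1)])
  moreover have "P dvd F (Suc n) - 1"
  proof -
    have "P dvd F (Suc n) - b ^ (k * r)"
      unfolding r by (rule dvd_trans[OF P_dvd_a F_mod_a(2)])
    moreover have "P dvd b ^ (k * r) - 1"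
    proof -
      have "[(b ^ k) ^ r = 1 ^ r] (mod P)"
        using P_dvd_b_power_k by (intro cong_pow) (simp add: cong_iff_dvd_diff)
      then show ?thesis by (simp add: cong_iff_dvd_diff power_mult)
    qed
    ultimately have "P dvd (F (Suc n) - b ^ (k * r)) + (b ^ (k * r) - 1)"
      by (rule dvd_add)
    then show ?thesis by simp
  qed
  ultimately show "returns_mod a b P n"
    by (simp add: returns_mod_def cong_0_iff cong_iff_dvd_diff)
qed

subsection \<open>The first coordinate\<close>

lemma P_nondvd_F_k: "\<not> P dvd F k"
  using odd_k P_nondvd_F_odd by (metis oddE Suc_eq_plus1)

lemma P_pow_dvd_F_iff: "P ^ e dvd F (2 ^ i * k) \<longleftrightarrow> e \<le> (2 ^ i - 1) * e1"
proof -
  let ?c = "g1 ^ (2 ^ i - 1) * F k ^ (2 ^ i)"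
  have "a ^ n = g1 ^ n * P ^ (n * e1)" for n
    unfolding a_eq by (simp add: power_mult_distrib power_mult[symmetric] mult.commute)
  then have eq: "F (2 ^ i * k) = ?c * P ^ ((2 ^ i - 1) * e1)"
    unfolding F_two_power_mult by (simp only: ac_simps)
  have "\<not> P dvd g1 ^ n" "\<not> P dvd F k ^ n" for n
    using prime_P g1_nondvd P_nondvd_F_k prime_elem_dvd_power by blast+
  then have c: "\<not> P dvd ?c"
    using prime_P by (simp add: prime_elem_dvd_mult_iff)
  then show ?thesis
    unfolding eq by (simp only: P_pow_dvd_mult_iff[OF c] P_pow_dvd_iff)
qed

lemma has_level_exists: "\<exists>V. has_level (2 ^ i * k) V"
proof -
  let ?Q = "\<lambda>e. returns_mod a b (P ^ e) (2 ^ i * k)"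
  have "\<not> ?Q (Suc ((2 ^ i - 1) * e1))"
    using P_pow_dvd_F_iff[of "Suc ((2 ^ i - 1) * e1)" i] by (simp only: returns_mod_iff) simp
  moreover have "?Q 0" by (simp add: returns_mod_iff)
  ultimately obtain V where "?Q V" "\<not> ?Q (Suc V)"
    using nat_induct[of ?Q] by blast
  then show ?thesis using has_levelI by blast
qed

lemma has_level_pos:
  assumes "has_level (2 ^ Suc i * k) V"
  shows "V > 0"
proof -
  have "2 * k dvd 2 ^ Suc i * k" by simp
  then have "returns_mod a b (P ^ 1) (2 ^ Suc i * k)"
    using returns_mod_P_iff by simp
  then have "1 \<le> V"
    using assms unfolding has_level_def by blast
  then show ?thesis by simp
qed

subsection \<open>The second coordinate\<close>

text \<open>Starting values for the induction on doublings. As \<open>k\<close> is odd, \<open>F k\<close> is a power of \<open>b\<close> modulo \<open>a\<close>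
  and \<open>F (k + 1)\<close> vanishes modulo \<open>a\<close>; squaring turns these congruences modulo \<open>P ^ e1\<close> into
  congruences modulo \<open>P ^ (2 * e1)\<close>.\<close>

lemma b_F_k_square: "P ^ (2 * e1) dvd b * (F k)\<^sup>2 - b ^ k"
  and H_k_square: "P ^ (2 * e1) dvd (H k)\<^sup>2 - 1"
proof -
  obtain n where n: "k = Suc (2 * n)"
    using odd_k by (metis oddE Suc_eq_plus1)
  have sq: "P ^ (2 * e1) dvd x\<^sup>2" if "a dvd x" for x
  proof -
    have "P ^ e1 dvd x" using that a_eq by (metis dvd_mult_left)
    then have "(P ^ e1)\<^sup>2 dvd x\<^sup>2" by (rule dvd_power_same)
    then show ?thesis by (simp add: power_mult[symmetric] mult.commute)
  qed
  have "P ^ (2 * e1) dvd (F k - b ^ n)\<^sup>2"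
    using F_mod_a(2)[of n] n sq by simp
  moreover have "b * (F k)\<^sup>2 - b ^ k = b * (F k - b ^ n)\<^sup>2"
    by (simp add: n diff_eq_add square_add power_mult[symmetric] algebra_simps)
  ultimately show "P ^ (2 * e1) dvd b * (F k)\<^sup>2 - b ^ k" by simp
  have "a dvd F (2 * Suc n)" by (rule F_mod_a)
  then have "a dvd F (2 * Suc n) - a * F k" by simp
  then have "P ^ (2 * e1) dvd (F (2 * Suc n) - a * F k)\<^sup>2" by (rule sq)
  moreover have "(H k)\<^sup>2 - 1 = (F (2 * Suc n) - a * F k)\<^sup>2"
    by (simp add: unit_defect_def n diff_eq_add square_add double_eq_0 add.assoc)
  ultimately show "P ^ (2 * e1) dvd (H k)\<^sup>2 - 1" by simp
qed

text \<open>The induction invariant: after removal of the factor \<open>P ^ ((2 ^ i - 1) * e1)\<close>, the constant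
  coordinate of \<open>t ^ (2 ^ i * k) - 1\<close> is \<open>g\<close> modulo \<open>P ^ e1\<close>, up to the unit
  \<open>b ^ (2 ^ (i - 1) - 1)\<close>. The unit accumulates because each doubling is multiplied by \<open>b\<close> to bring its term \<open>b * (F n)\<^sup>2\<close> into the form of the process.\<close>

definition approximates :: "nat \<Rightarrow> 'a poly \<Rightarrow> bool" where
  "approximates i g \<longleftrightarrow>
     P ^ (2 ^ i * e1) dvd b ^ (2 ^ (i - 1) - 1) * H (2 ^ i * k) - P ^ ((2 ^ i - 1) * e1) * g"

lemma approximates_1: "approximates 1 g2"
proof -
  have "H (2 * k) - P ^ e1 * g2 = ((H k)\<^sup>2 - 1) + (b * (F k)\<^sup>2 - b ^ k)"
    unfolding H_double b_power[symmetric] by (simp add: diff_eq_add add_ac)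
  then show ?thesis
    unfolding approximates_def using dvd_add[OF H_k_square b_F_k_square] by simp
qed

text \<open>\<open>b * (F k)\<^sup>2\<close> is congruent to \<open>b ^ k\<close> and hence to 1 modulo \<open>P ^ e1\<close>; one squaring doubles the
  exponent of the modulus.\<close>

lemma b_F_power_cong:
  assumes "i \<ge> 1"
  shows "P ^ (2 * e1) dvd (b * (F k)\<^sup>2) ^ (2 ^ i) - 1"
proof -
  have "P ^ e1 dvd b ^ k - 1" by (simp add: b_power)
  moreover have "P ^ e1 dvd b * (F k)\<^sup>2 - b ^ k"
    using b_F_k_square by (rule power_le_dvd) simp
  ultimately have "P ^ e1 dvd (b * (F k)\<^sup>2 - b ^ k) + (b ^ k - 1)"
    by (rule dvd_add[rotated])
  then have "[b * (F k)\<^sup>2 = 1] (mod P ^ e1)"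
    by (simp add: cong_iff_dvd_diff)
  then have "[(b * (F k)\<^sup>2) ^ (2 ^ (i - 1)) = 1 ^ (2 ^ (i - 1))] (mod P ^ e1)"
    by (rule cong_pow)
  then have "P ^ e1 dvd (b * (F k)\<^sup>2) ^ (2 ^ (i - 1)) - 1"
    by (simp add: cong_iff_dvd_diff)
  then have "(P ^ e1)\<^sup>2 dvd ((b * (F k)\<^sup>2) ^ (2 ^ (i - 1)) - 1)\<^sup>2"
    by (rule dvd_power_same)
  moreover have "2 ^ (i - 1) * 2 = (2 ^ i :: nat)"
    using assms by (metis Suc_diff_1 less_eq_Suc_le One_nat_def power_Suc2)
  ultimately show ?thesis
    by (simp add: diff_eq_add square_add power_mult[symmetric] mult.commute del: power_mult_distrib)
qed

definition residual :: "nat \<Rightarrow> 'a poly \<Rightarrow> 'a poly" where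
  "residual i g = g1 ^ (2 ^ i - 2) + b * g\<^sup>2"

text \<open>One doubling. Multiplied by the unit, \<open>H\<^sup>2\<close> contributes \<open>b g\<^sup>2\<close> and, by the
  closed form of \<open>F\<close>, the term \<open>b F\<^sup>2\<close> contributes \<open>g1 ^ (2 ^ (i + 1) - 2)\<close> times
  \<open>(b (F k)\<^sup>2) ^ (2 ^ i)\<close>, a factor that is 1 to the precision needed.\<close>

lemma H_residual:
  assumes "i \<ge> 1" "approximates i g"
  shows "P ^ (2 ^ Suc i * e1) dvd
    b ^ (2 ^ i - 1) * H (2 ^ Suc i * k) - P ^ ((2 ^ Suc i - 2) * e1) * residual (Suc i) g"
proof -
  define c where "c = (2 ^ (i - 1) :: nat)"
  define N where "N = (2 ^ i :: nat)"
  have N: "N = 2 * c" "c \<ge> 1" "2 ^ Suc i = 2 * N"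
    using assms(1) by (auto simp: c_def N_def simp flip: power_Suc)
  define h where "h = H (N * k)"
  define f where "f = F k"
  let ?X = "b ^ (c - 1) * h"
  have "P ^ (N * e1) dvd ?X - P ^ ((N - 1) * e1) * g"
    using assms(2) by (simp add: approximates_def c_def N_def h_def)
  then have "(P ^ (N * e1))\<^sup>2 dvd (?X - P ^ ((N - 1) * e1) * g)\<^sup>2"
    by (rule dvd_power_same)
  moreover have "(?X - P ^ ((N - 1) * e1) * g)\<^sup>2 = ?X\<^sup>2 - P ^ ((2 * N - 2) * e1) * g\<^sup>2"
  proof -
    have "(N - 1) * e1 * 2 = (2 * N - 2) * e1"
      by (simp add: diff_mult_distrib)
    then show ?thesis
      by (simp only: diff_eq_add square_add power_mult_distrib[of _ g] power_mult[symmetric])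
  qed
  moreover have "(P ^ (N * e1))\<^sup>2 = P ^ (2 * N * e1)"
    by (simp add: power_mult[symmetric] mult_ac)
  ultimately have 1: "P ^ (2 * N * e1) dvd b * (?X\<^sup>2 - P ^ ((2 * N - 2) * e1) * g\<^sup>2)"
    by simp
  have "P ^ (2 * e1) dvd (b * f\<^sup>2) ^ N - 1"
    using b_F_power_cong[OF assms(1)] by (simp add: f_def N_def)
  then have "P ^ ((2 * N - 2) * e1) * P ^ (2 * e1) dvd
      P ^ ((2 * N - 2) * e1) * g1 ^ (2 * N - 2) * ((b * f\<^sup>2) ^ N - 1)"
    by (intro mult_dvd_mono dvd_triv_left)
  moreover have "P ^ ((2 * N - 2) * e1) * P ^ (2 * e1) = P ^ (2 * N * e1)"
    using N by (simp add: power_add[symmetric] algebra_simps)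
  ultimately have 2: "P ^ (2 * N * e1) dvd
      P ^ ((2 * N - 2) * e1) * g1 ^ (2 * N - 2) * ((b * f\<^sup>2) ^ N - 1)"
    by simp
  have fN: "(F (N * k))\<^sup>2 = P ^ ((2 * N - 2) * e1) * g1 ^ (2 * N - 2) * f ^ (2 * N)"
  proof -
    have "(F (N * k))\<^sup>2 = a ^ ((N - 1) * 2) * f ^ (N * 2)"
      using F_two_power_mult[of i k]
      by (simp add: N_def f_def power_mult_distrib power_mult)
    moreover have "(N - 1) * 2 = 2 * N - 2" by simp
    ultimately show ?thesis
      by (simp add: a_eq power_mult_distrib power_mult[symmetric] mult_ac)
  qed
  have bX: "b * ?X\<^sup>2 = b ^ (N - 1) * h\<^sup>2"
  proof -
    have "b * ?X\<^sup>2 = b ^ Suc (2 * (c - 1)) * h\<^sup>2"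
      by (simp only: power_mult_distrib power_even_eq power_Suc mult.assoc)
    moreover have "Suc (2 * (c - 1)) = N - 1" using N by simp
    ultimately show ?thesis by (simp only:)
  qed
  have bf: "b ^ (N - 1) * (b * f ^ (2 * N)) = (b * f\<^sup>2) ^ N"
  proof -
    have "b ^ (N - 1) * b = b ^ N" using N by (simp add: power_Suc2[symmetric])
    then show ?thesis
      by (simp add: power_mult_distrib power_mult[symmetric] mult.assoc[symmetric])
  qed
  have ring: "x * (y + b * (z * w * v)) - z * (w + b * u)
      = (x * y - b * (z * u)) + z * w * (x * (b * v) - 1)" for x y z w v u
    by (simp add: algebra_simps)
  have "b ^ (N - 1) * H (2 * (N * k)) - P ^ ((2 * N - 2) * e1) * (g1 ^ (2 * N - 2) + b * g\<^sup>2)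
      = (b ^ (N - 1) * h\<^sup>2 - b * (P ^ ((2 * N - 2) * e1) * g\<^sup>2))
        + P ^ ((2 * N - 2) * e1) * g1 ^ (2 * N - 2) * (b ^ (N - 1) * (b * f ^ (2 * N)) - 1)"
    by (simp only: H_double fN h_def[symmetric] ring)
  also have "\<dots> = b * (?X\<^sup>2 - P ^ ((2 * N - 2) * e1) * g\<^sup>2)
        + P ^ ((2 * N - 2) * e1) * g1 ^ (2 * N - 2) * ((b * f\<^sup>2) ^ N - 1)"
    by (simp only: bX bf right_diff_distrib[of b])
  finally have "b ^ (N - 1) * H (2 * (N * k))
        - P ^ ((2 * N - 2) * e1) * (g1 ^ (2 * N - 2) + b * g\<^sup>2)
      = b * (?X\<^sup>2 - P ^ ((2 * N - 2) * e1) * g\<^sup>2)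
        + P ^ ((2 * N - 2) * e1) * g1 ^ (2 * N - 2) * ((b * f\<^sup>2) ^ N - 1)" .
  then have "P ^ (2 * N * e1) dvd b ^ (N - 1) * H (2 * (N * k)) -
      P ^ ((2 * N - 2) * e1) * (g1 ^ (2 * N - 2) + b * g\<^sup>2)"
    using dvd_add[OF 1 2] by simp
  then show ?thesis
    unfolding residual_def N(3) N_def[symmetric] by (simp add: mult.assoc)
qed

text \<open>The process divides by \<open>P ^ e1\<close>; this restores the invariant for the next index.\<close>

lemma approximates_Suc:
  assumes "i \<ge> 1" "approximates i g" "P ^ e1 dvd residual (Suc i) g"
  shows "approximates (Suc i) (residual (Suc i) g div P ^ e1)"
proof -
  let ?g = "residual (Suc i) g div P ^ e1"
  have "(2 ^ Suc i - 1) * e1 = (2 ^ Suc i - 2) * e1 + e1"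
    by (rule pred_mult_eq) simp
  then have "P ^ ((2 ^ Suc i - 1) * e1) * ?g = P ^ ((2 ^ Suc i - 2) * e1) * (P ^ e1 * ?g)"
    by (simp only: power_add mult.assoc)
  also have "P ^ e1 * ?g = residual (Suc i) g"
    using assms(3) by simp
  finally have "P ^ ((2 ^ Suc i - 1) * e1) * ?g = P ^ ((2 ^ Suc i - 2) * e1) * residual (Suc i) g" .
  then show ?thesis
    using H_residual[OF assms(1,2)] by (simp only: approximates_def diff_Suc_1)
qed

text \<open>The error term of \<open>H_residual\<close> is invisible for exponents up to \<open>2 ^ (i + 1) * e1\<close>, which lies above
  the valuation of the first coordinate. So the valuation of \<open>H\<close> is known as far as the minimum
  of the two valuations requires.\<close>

lemma P_pow_dvd_H_iff:
  assumes "i \<ge> 1" "approximates i g" "e \<le> 2 ^ Suc i * e1"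
  shows "P ^ e dvd H (2 ^ Suc i * k) \<longleftrightarrow>
    enat e \<le> enat ((2 ^ Suc i - 2) * e1) + val P (residual (Suc i) g)"
proof -
  let ?q = "residual (Suc i) g" and ?d = "(2 ^ Suc i - 2) * e1"
  have "P ^ e dvd b ^ (2 ^ i - 1) * H (2 ^ Suc i * k) - P ^ ?d * ?q"
    using H_residual[OF assms(1,2)] assms(3) by (rule power_le_dvd)
  then have "P ^ e dvd b ^ (2 ^ i - 1) * H (2 ^ Suc i * k) \<longleftrightarrow> P ^ e dvd P ^ ?d * ?q"
    by (metis diff_add_cancel dvd_add_right_iff)
  then have "P ^ e dvd H (2 ^ Suc i * k) \<longleftrightarrow> P ^ e dvd P ^ ?d * ?q"
    using P_pow_dvd_mult_iff[OF P_nondvd_b_power] by blast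
  also have "\<dots> \<longleftrightarrow> enat e \<le> enat ?d + val P ?q"
  proof (cases "e \<le> ?d")
    case True
    then have "P ^ e dvd P ^ ?d * ?q"
      by (meson dvd_mult2 le_imp_power_dvd)
    moreover have "enat e \<le> enat ?d + val P ?q"
      using True by (meson enat_ord_simps(1) le_iff_add order_trans)
    ultimately show ?thesis by simp
  next
    case False
    then obtain r where r: "e = ?d + r" by (metis le_add_diff_inverse nat_le_linear)
    have "P ^ e dvd P ^ ?d * ?q \<longleftrightarrow> P ^ r dvd ?q"
      unfolding r power_add using P_nonzero by simp
    also have "\<dots> \<longleftrightarrow> enat r \<le> val P ?q"
      by (rule val_iff[symmetric])
    also have "\<dots> \<longleftrightarrow> enat e \<le> enat ?d + val P ?q"
      unfolding r plus_enat_simps(1)[symmetric] by (cases "val P ?q") auto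
    finally show ?thesis .
  qed
  finally show ?thesis .
qed

text \<open>The minimum of the two valuations. They agree only if \<open>m = e1\<close>. The proof writes exponents as
  \<open>(2 ^ (i + 1) - 2) * e1\<close> plus an excess. The excess is \<open>e1\<close> for \<open>F\<close>; for \<open>H\<close> it is \<open>m\<close>, as far
  as it can be compared with \<open>e1\<close>.\<close>

lemma level_of_residual:
  assumes "i \<ge> 1" "approximates i g"
  defines "m \<equiv> val P (residual (Suc i) g)"
  shows "\<exists>V. has_level (2 ^ Suc i * k) V \<and>
    enat V = min (enat ((2 ^ Suc i - 1) * e1)) (enat ((2 ^ Suc i - 2) * e1) + m) \<and>
    (m \<noteq> enat e1 \<longrightarrow> unbalanced (2 ^ Suc i * k) V)"
proof -
  define N where "N = (2 ^ Suc i :: nat)"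
  have "N \<ge> 2" by (simp add: N_def)
  have N1: "(N - 1) * e1 = (N - 2) * e1 + e1"
    using \<open>N \<ge> 2\<close> by (rule pred_mult_eq)
  have N2: "N * e1 = (N - 2) * e1 + 2 * e1"
    using \<open>N \<ge> 2\<close> by (auto dest!: le_Suc_ex)
  obtain r where r: "enat r = min (enat e1) m"
    by (metis enat_ord_simps(4) infinity_ileE min.cobounded1 not_infinity_eq)
  define V where "V = (N - 2) * e1 + r"
  have "r \<le> e1" using r by (metis enat_ord_simps(1) min.cobounded1)
  have F: "P ^ e dvd F (N * k) \<longleftrightarrow> e \<le> (N - 2) * e1 + e1" for e
    unfolding N_def using P_pow_dvd_F_iff[of e "Suc i"] N1 by (simp add: N_def)
  have H: "P ^ e dvd H (N * k) \<longleftrightarrow> enat e \<le> enat ((N - 2) * e1) + m"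
    if "e \<le> (N - 2) * e1 + 2 * e1" for e
    using P_pow_dvd_H_iff[OF assms(1,2), of e] that N2 by (simp add: N_def m_def)
  have H': "P ^ ((N - 2) * e1 + s) dvd H (N * k) \<longleftrightarrow> enat s \<le> m" if "s \<le> 2 * e1" for s
    using H[of "(N - 2) * e1 + s"] that
    by (cases m) (auto simp flip: plus_enat_simps(1))
  have rm: "enat s \<le> m \<longleftrightarrow> s \<le> r" if "s \<le> e1" for s
    using r that by (metis enat_ord_simps(1) min.bounded_iff)
  have dvd: "P ^ V dvd F (N * k)" "P ^ V dvd H (N * k)"
    unfolding V_def using \<open>r \<le> e1\<close> rm[of r] by (auto simp: F H')
  have SucV: "Suc V = (N - 2) * e1 + Suc r" by (simp add: V_def)
  have FS: "P ^ Suc V dvd F (N * k) \<longleftrightarrow> Suc r \<le> e1"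
    unfolding F SucV by simp
  have HS: "P ^ Suc V dvd H (N * k) \<longleftrightarrow> enat (Suc r) \<le> m"
    unfolding SucV using \<open>r \<le> e1\<close> e1_pos by (intro H') simp
  have "\<not> (P ^ Suc V dvd F (N * k) \<and> P ^ Suc V dvd H (N * k))"
    unfolding FS HS using rm[of "Suc r"] by auto
  then have "has_level (N * k) V"
    using dvd by (intro has_levelI) (auto simp only: returns_mod_iff)
  moreover have "unbalanced (N * k) V" if "m \<noteq> enat e1"
  proof -
    have "Suc r \<le> e1 \<longleftrightarrow> \<not> enat (Suc r) \<le> m"
    proof (cases "r < e1")
      case True
      then show ?thesis using rm[of "Suc r"] by auto
    next
      case False
      then have "r = e1" using \<open>r \<le> e1\<close> by simp
      then have "enat e1 < m" using r that by (metis min.cobounded2 order_le_imp_less_or_eq)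
      then show ?thesis using \<open>r = e1\<close> by (simp add: Suc_ile_eq)
    qed
    then show ?thesis
      unfolding unbalanced_def FS HS using dvd by blast
  qed
  moreover have "enat V = min (enat ((N - 1) * e1)) (enat ((N - 2) * e1) + m)"
    unfolding V_def N1 using r by (cases m) (auto simp: min_def split: if_splits)
  ultimately show ?thesis
    unfolding N_def by blast
qed

lemma process_approximates:
  assumes "process b P e1 g1 g2 i g m"
  shows "i \<ge> 2 \<and> approximates (i - 1) g \<and> m = val P (residual i g)"
  using assms
proof induction
  case start
  then show ?case using approximates_1 by (simp add: residual_def)
next
  case (step i g m g')
  then obtain n where n: "i = Suc n" "n \<ge> 1"
    by (metis One_nat_def Suc_1 Suc_le_mono not0_implies_Suc not_less_eq_eq zero_le)
  have "P ^ e1 dvd residual i g"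
    using step val_iff[of e1 "residual i g"] by simp
  then show ?case
    using step approximates_Suc[of n g] n by (simp add: residual_def)
qed

subsection \<open>Periods from levels\<close>

text \<open>The period is a multiple of \<open>2 * k\<close>, the period modulo \<open>P\<close>, and divides \<open>2 ^ s * (2 * k)\<close> once \<open>P ^ e\<close>
  divides both coordinates there. Hence the quotient by \<open>2 * k\<close> is a power of 2.\<close>

lemma period_mod_P_pow:
  assumes U: "\<And>i. has_level (2 ^ Suc i * k) (U i)" and "e > 0" and s: "\<exists>s. e \<le> U s"
  shows "period_mod a b (P ^ e) = 2 ^ Suc (LEAST i. e \<le> U i) * k"
proof -
  let ?T = "period_mod a b (P ^ e)"
  define l where "l = (LEAST i. e \<le> U i)"
  have ret: "returns_mod a b (P ^ e) (2 ^ Suc i * k) \<longleftrightarrow> e \<le> U i" for i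
    using U[of i] unfolding has_level_def by blast
  have "e \<le> U l"
    unfolding l_def using s by (rule LeastI_ex)
  then have R: "returns_mod a b (P ^ e) (2 ^ Suc l * k)"
    using ret by blast
  have pos: "2 ^ Suc l * k > 0" using k_pos by simp
  have "returns_mod a b (P ^ 1) ?T"
    by (rule returns_mod_P_pow_le[OF returns_mod_period[OF pos R]]) (use \<open>e > 0\<close> in simp)
  then have "2 * k dvd ?T" using returns_mod_P_iff by simp
  then obtain r where r: "?T = 2 * k * r" by blast
  have "?T dvd 2 ^ Suc l * k"
    by (rule period_mod_dvd[OF pos R])
  then have "(2 * k) * r dvd (2 * k) * 2 ^ l"
    by (simp add: r mult_ac)
  then have "r dvd 2 ^ l"
    using k_pos by simp
  then obtain i where i: "i \<le> l" "r = 2 ^ i"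
    using divides_primepow_nat two_is_prime_nat by blast
  have T: "?T = 2 ^ Suc i * k" by (simp add: r i)
  then have "e \<le> U i"
    using returns_mod_period[OF pos R] ret by simp
  then have "l \<le> i"
    unfolding l_def by (rule Least_le)
  then show ?thesis using T i by (simp add: l_def)
qed

lemma is_e'_of_level:
  assumes "i \<ge> 1" "has_level (2 ^ i * k) V"
  shows "is_e' a b P i V"
proof -
  have "\<forall>i. \<exists>V. has_level (2 ^ Suc i * k) V"
    using has_level_exists by blast
  then obtain U where U: "\<And>i. has_level (2 ^ Suc i * k) (U i)"
    by metis
  have pos: "U i > 0" for i using has_level_pos U by blast
  have "U i < U (Suc i)" for i
    using has_level_double_gt[of "2 ^ Suc i * k" "U i" "U (Suc i)"] U[of i] U[of "Suc i"] pos
    by (simp add: mult.assoc)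
  then have mono: "strict_mono U" by (simp add: strict_mono_Suc_iff)
  have "inj (\<lambda>i. 2 ^ Suc i * k)"
    using k_pos by (auto intro!: injI)
  then have "{e. e > 0 \<and> period_mod a b (P ^ e) \<noteq> period_mod a b (P ^ (e + 1))} = range U"
    using mono pos period_mod_P_pow[OF U _ strict_mono_exceeds[OF mono]]
    by (intro jumps_eq_range) auto
  then have "is_e' a b P (Suc n) (U n)" for n
    using ith_smallest_range[OF mono] by (simp add: is_e'_def)
  moreover obtain n where "i = Suc n" using assms(1) by (cases i) auto
  moreover have "U n = V" using U[of n] assms(2) \<open>i = Suc n\<close> has_level_unique by blast
  ultimately show ?thesis by blast
qed

end

section \<open>The process and the period jumps\<close>

lemma process_Suc_imp:
  assumes "process b P e1 g1 g2 (Suc i) g m" "i \<ge> 2"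
  shows "\<exists>g'. process b P e1 g1 g2 i g' (enat e1)"
  using assms(1) by cases (use assms(2) in auto)

lemma process_index_ge: "process b P e1 g1 g2 i g m \<Longrightarrow> i \<ge> 2"
  by (induction rule: process.induct) auto

text \<open>The process is deterministic. The base case has to exclude that index 2 is reached by a step,
  which is what the lower bound on indices is for.\<close>

lemma process_unique:
  assumes "process b P e1 g1 g2 i g m" "process b P e1 g1 g2 i g' m'"
  shows "g = g' \<and> m = m'"
  using assms
proof (induction arbitrary: g' m')
  case start
  from start show ?case
    by cases (auto dest: process_index_ge)
next
  case (step i g m h)
  note IH = step.IH and h = step.hyps(3)
  from step.prems show ?case
  proof cases
    case start
    then show ?thesis using process_index_ge[OF step.hyps(1)] by simp
  next
    case (step i' x y)
    then show ?thesis using IH h by auto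
  qed
qed

theorem theorem4p13:
  fixes a b P g1 g2 :: "'a::{finite,field} poly"
    and p l k e1 j :: nat
    and g :: "nat \<Rightarrow> 'a poly" and m :: "nat \<Rightarrow> enat"
  assumes "prime p" and "l \<ge> 1" and "card (UNIV :: 'a set) = p ^ l"
    and "b \<noteq> 0" and "irreducible P" and "coprime b P"
    and "\<not> (degree a = 0 \<and> degree b = 0)"
    and "p = 2"
    and "[discr a b = 0] (mod P)"
    and "is_e a b P 1 e1" and "is_e' a b P 1 e1"
    and "k = ord_mod P b" and "val P (b ^ k - 1) = enat e1"
    and "g1 = a div P ^ e1" and "g2 = (b ^ k - 1) div P ^ e1"
    and "j \<ge> 2"
    and "\<forall>i\<in>{2..j}. process b P e1 g1 g2 i (g i) (m i)"
    and "\<nexists>g' m'. process b P e1 g1 g2 (j + 1) g' m'"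
  shows "(\<forall>i\<in>{2..j}. \<exists>e. is_e' a b P i e \<and>
            enat e = (if i < j then enat ((2 ^ i - 1) * e1)
                      else min (enat ((2 ^ j - 1) * e1)) (enat ((2 ^ j - 2) * e1) + m j)))
       \<and> (\<forall>i>j. \<exists>e. is_e' a b P j e \<and> is_e' a b P i (2 ^ (i - j) * e))"
  proof -
  have two_dvd: "CHAR('a) dvd 2 ^ l"
    using CHAR_dvd_CARD[where 'a = 'a] assms(3,8) by simp
  have "prime CHAR('a)"
    by (rule prime_CHAR_semidom) (simp add: finite_imp_CHAR_pos)
  then have "CHAR('a) = 2"
    using two_dvd by (metis prime_dvd_power primes_dvd_imp_eq two_is_prime_nat)
  then have "(2 :: 'a) = 0"
    by (metis of_nat_CHAR of_nat_numeral)
  then have two: "(2 :: 'a poly) = 0"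
    by (metis of_nat_numeral of_nat_poly pCons_0_0)
  have prime: "prime_elem P"
    using assms(5) by (rule field_poly_irreducible_imp_prime)
  have "(4 :: 'a poly) = 2 * 2" by simp
  then have "discr a b = a\<^sup>2"
    by (simp add: discr_def two)
  then have "P dvd a"
    using assms(9) prime prime_elem_dvd_power by (auto simp: cong_0_iff)
  moreover have "\<not> P dvd b"
    using assms(6) prime by (meson coprime_common_divisor dvd_refl not_prime_unit prime_elem_not_unit)
  ultimately interpret char2_fib a b P
    using two prime by unfold_locales
  have e1: "e1 > 0" "P ^ e1 dvd a" "\<not> P ^ Suc e1 dvd a"
    using first_rank_jump[OF assms(10)] by auto
  have a: "a = P ^ e1 * g1"
    using e1(2) assms(14) by simp
  have "P ^ e1 dvd b ^ k - 1"
    using val_iff[of e1 "b ^ k - 1"] assms(13) by simp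
  then have bk: "b ^ k - 1 = P ^ e1 * g2"
    using assms(15) by simp
  have "k > 0"
    using assms(13) by (cases k) (auto simp: val_def)
  have least: "\<not> P dvd b ^ n - 1" if "0 < n" "n < k" for n
    using that not_less_Least[of n "\<lambda>n. n > 0 \<and> [b ^ n = 1] (mod P)"] assms(12)
    by (auto simp: ord_mod_def cong_iff_dvd_diff)
  interpret char2_fib_order a b P e1 k g1 g2
  proof
    show "\<not> P dvd g1"
      using e1(3) unfolding a by (metis mult_dvd_mono dvd_refl power_Suc2)
  qed (use e1 a bk \<open>k > 0\<close> least in auto)

  have proc: "process b P e1 g1 g2 i (g i) (m i)" if "i \<in> {2..j}" for i
    using that assms(17) by blast
  \<comment> \<open>That the process reaches the next index says that its condition was met at this one.\<close>
  have m_e1: "m i = enat e1" if "2 \<le> i" "i < j" for i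
  proof -
    have "process b P e1 g1 g2 (Suc i) (g (Suc i)) (m (Suc i))"
      using that by (intro proc) auto
    then obtain g' where "process b P e1 g1 g2 i g' (enat e1)"
      using process_Suc_imp \<open>2 \<le> i\<close> by blast
    moreover have "process b P e1 g1 g2 i (g i) (m i)"
      using that by (intro proc) auto
    ultimately show ?thesis
      using process_unique by blast
  qed
  have m_j: "m j \<noteq> enat e1"
    using assms(16,18) proc[of j] process.step by (metis atLeastAtMost_iff order_refl)
  have level: "\<exists>V. has_level (2 ^ i * k) V \<and>
      enat V = min (enat ((2 ^ i - 1) * e1)) (enat ((2 ^ i - 2) * e1) + m i) \<and>
      (m i \<noteq> enat e1 \<longrightarrow> unbalanced (2 ^ i * k) V)" if "i \<in> {2..j}" for i
  proof -
    have "approximates (i - 1) (g i)" "m i = val P (residual i (g i))"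
      using process_approximates[OF proc[OF that]] by auto
    moreover have "Suc (i - 1) = i" "i - 1 \<ge> 1" using that by auto
    ultimately show ?thesis
      using level_of_residual[of "i - 1" "g i"] by simp
  qed
  have "\<exists>e. is_e' a b P i e \<and>
      enat e = (if i < j then enat ((2 ^ i - 1) * e1)
                else min (enat ((2 ^ j - 1) * e1)) (enat ((2 ^ j - 2) * e1) + m j))"
    if i: "i \<in> {2..j}" for i
  proof -
    obtain V where V: "has_level (2 ^ i * k) V"
      "enat V = min (enat ((2 ^ i - 1) * e1)) (enat ((2 ^ i - 2) * e1) + m i)"
      using level[OF i] by blast
    have "is_e' a b P i V"
      using V(1) i by (intro is_e'_of_level) auto
    moreover have "V = (2 ^ i - 1) * e1" if "i < j"
    proof -
      have "2 ^ i \<ge> (2 :: nat)" using i self_le_power[of "2::nat" i] by simp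
      then have "(2 ^ i - 1) * e1 = (2 ^ i - 2) * e1 + e1"
        by (rule pred_mult_eq)
      then show ?thesis using V(2) m_e1[of i] that i by simp
    qed
    ultimately show ?thesis
      using V(2) i by (cases "i < j") auto
  qed
  moreover have "\<exists>e. is_e' a b P j e \<and> is_e' a b P i (2 ^ (i - j) * e)" if "i > j" for i
  proof -
    obtain V where V: "has_level (2 ^ j * k) V" "unbalanced (2 ^ j * k) V"
      using level[of j] m_j assms(16) by auto
    have "unbalanced (2 ^ (i - j) * (2 ^ j * k)) (2 ^ (i - j) * V)"
      by (rule unbalanced_two_power[OF V(2)])
    moreover have "2 ^ (i - j) * (2 ^ j * k) = 2 ^ i * k"
      using that by (simp add: mult.assoc[symmetric] power_add[symmetric])
    ultimately have "has_level (2 ^ i * k) (2 ^ (i - j) * V)"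
      using unbalanced_imp_has_level by simp
    then show ?thesis
      using is_e'_of_level V(1) assms(16) that by (metis One_nat_def Suc_1 Suc_leD le_trans less_imp_le_nat)
  qed
  ultimately show ?thesis by blast
qed

end
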